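(* Let $t\ge 1$ and let the multi-target configuration after the update at time $t-1$ be $$\bar{\mathcal P}_{t-1}=\{(\bar p^{k}_{t-1},1)\}_{k\in \mathbb I^{\mathrm m}_{t-1}}\cup\{(\bar p^{\mathrm u}_{t-1},n^{\mathrm u}_{t-1})\}\cup\bar{\mathcal P}^{\psi,\varphi}_{t-1}.$$ Under the approximation (A.1) that the hypotheses formed by predicting each single-target law with the transitions $q^\pi_t$ and $q^\omega_t$ are independent (and hence co-exist in a single configuration), the multi-target configuration after prediction to time $t$ is $$\bar{\mathcal P}_{t|t-1}=\{(\bar p^{i}_{t|t-1},1)\}_{i\in\mathbb I^{\mathrm m}_{t|t-1}}\cup\{(\bar p^{\mathrm u}_{t|t-1},n^{\mathrm u}_{t|t-1})\}\cup\bar{\mathcal P}^{\psi,\varphi}_{t-1},$$ where $n^{\mathrm u}_{t|t-1}=n^{\mathrm u}_{t-1}+n^{\alpha}_t$ is the predicted number of never-detected targets, where for the never-detected targets $$\bar p^{\mathrm u}_{t|t-1}(\mathbf x)=\frac{n^{\mathrm u}_{t-1}\int \bar q^{\pi}_t(\mathbf x\mid\mathbf x')\,\bar p^{\mathrm u}_{t-1}(\mathbf x')\,\mathrm d\mathbf x'+n^{\alpha}_t\,\bar q^{\alpha}_t(\mathbf x\mid\psi_\sharp)}{n^{\mathrm u}_{t-1}+n^{\alpha}_t},\qquad \mathbf x\in\bar{\mathbf X},$$ and where, for every $i\in\mathbb I^{\mathrm m}_{t|t-1}$ obtained by predicting the hypothesis $k\in\mathbb I^{\mathrm m}_{t-1}$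 with the transition $\iota\in\{\pi,\omega\}$, $$\bar p^{i}_{t|t-1}(\mathbf x)=\int\bar q^{\iota}_t(\mathbf x\mid\mathbf x')\,\bar p^{k}_{t-1}(\mathbf x')\,\mathrm d\mathbf x',\qquad \mathbf x\in\bar{\mathbf X}.$$
   Context: **Spaces.** $\mathbf X=\mathbf X^\bullet\cup\{\psi_\sharp,\psi_\flat\}$ with $\mathbf X^\bullet=\mathbb R^d$ and isolated points $\psi_\sharp$ (state of targets outside the area of interest) and $\psi_\flat$ (state of false-alarm generators). $\bar{\mathbf X}=\mathbf X\cup\{\varphi\}$, with $\varphi$ an isolated point (virtual state of a target whose existence is assumed by a false hypothesis). Integrals over $\bar{\mathbf X}$ are Lebesgue integrals over $\mathbf X^\bullet$ plus the sum of the values at the isolated points; laws are densities in this sense; for an isolated point $a$, $\delta_a(\mathbf x)=1$ if $\mathbf x=a$ and $0$ otherwise. **Transitions.** For $\iota\in\{\alpha,\pi,\omega\}$, $q^\iota_t(\cdot\mid\cdot)\ge0$ is a sub-transition function on $\mathbf X$, i.e. $\int_{\mathbf X} q^\iota_t(\mathbf x'\mid\mathbf x)\,\mathrm d\mathbf x'\le 1$, with $q^\iota_t(\mathbf x'\mid\psi_\flat)=q^\iota_t(\psi_\flat\mid\mathbf x)=0$ for all $\mathbf x,\mathbf x'\ne\psi_\flat$, and: - (appearance) $q^\alpha_t(\cdot\mid\mathbf x)=0$ for $\mathbf x\ne\psi_\sharp$, and $q^\alpha_t(\psi_\sharp\mid\psi_\sharp)=0$; - (persistence) $q^\pi_t(\psi_\sharp\mid\mathbf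 x)=0$ for $\mathbf x\in\mathbf X^\bullet$, and $q^\pi_t(\psi_\sharp\mid\psi_\sharp)=q^\pi_t(\psi_\flat\mid\psi_\flat)=1$; - (disappearance) $q^\omega_t(\mathbf x'\mid\mathbf x)=0$ for $\mathbf x,\mathbf x'\in\mathbf X^\bullet$, and $q^\omega_t(\cdot\mid\psi_\sharp)=q^\omega_t(\cdot\mid\psi_\flat)=0$; - $q^\omega_t(\psi_\sharp\mid\mathbf x)+\int_{\mathbf X} q^\pi_t(\mathbf x'\mid\mathbf x)\,\mathrm d\mathbf x'=1$ for all $\mathbf x\in\mathbf X$. The extension $\bar q^\iota_t$ to $\bar{\mathbf X}$ is: $\bar q^\iota_t(\mathbf x'\mid\mathbf x)=q^\iota_t(\mathbf x'\mid\mathbf x)$ for $\mathbf x,\mathbf x'\in\mathbf X$; $\bar q^\iota_t(\varphi\mid\mathbf x)=1-\int_{\mathbf X}q^\iota_t(\mathbf x''\mid\mathbf x)\,\mathrm d\mathbf x''$ for $\mathbf x\in\mathbf X$; $\bar q^\iota_t(\varphi\mid\varphi)=1$ and $\bar q^\iota_t(\mathbf x'\mid\varphi)=0$ for $\mathbf x'\in\mathbf X$. The transition $\bar q^\alpha_t$ is used exactly $n^\alpha_t\in\mathbb N$ times, with $n^\alpha_t$ larger than the number of observations at time $t$; $\bar q^\pi_t$ and $\bar q^\omega_t$ have unconstrained multiplicity. **Configurations.** A multi-target configuration is an indexed family $\{(\bar p_i,n_i)\}_{i}$ of probability laws $\bar p_i$ on $\bar{\mathbf X}$ with multiplicities $n_i$: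 $n_i$ targets (hypotheses) have law $\bar p_i$. Multiplicities are finite except possibly for $\delta_{\psi_\sharp},\delta_{\psi_\flat},\delta_\varphi$, for which $\infty$ is allowed. $\mathbb I^{\mathrm m}_{t-1}$ is the finite index set of the hypotheses for targets detected at least once up to time $t-1$. The superscript $\mathrm u$ refers to the single group of indistinguishable targets which are in the state space but have never been detected. $\bar{\mathcal P}^{\psi,\varphi}_{t-1}$ consists of false-alarm generators (law $\delta_{\psi_\flat}$; those that never produced a false alarm have multiplicity $\infty$), yet-to-appear targets $(\delta_{\psi_\sharp},\infty)$, and erroneous hypotheses $(\delta_\varphi,n_\varphi)$, where the value of $n_\varphi$ is irrelevant and not tracked (so hypotheses with law $\delta_\varphi$ can be absorbed into it). **Mixing.** Mixing $(\bar p_i,n_i)$ and $(\bar p_j,n_j)$ replaces them by $\big((n_i\bar p_i+n_j\bar p_j)/(n_i+n_j),\,n_i+n_j\big)$; mixing an element of finite multiplicity with $(\delta_{\psi_\sharp},\infty)$ gives $(\delta_{\psi_\sharp},\infty)$. Two simplifications are always applied: (S.1) the appearing targets are mixed with the never-detected ones; (S.2) the never-detected targets that disappeared are mixed with $\delta_{\psi_\sharp}$. **Prediction under (A.1).** Predicting a law $\bar p$ with the transition $\iota$ gives the law $\int\bar q^\iota_t(\cdot\mid\mathbf x')\bar p(\mathbf x')\,\mathrm d\mathbf x'$. Exactly $n^\alpha_t$ of the targets with law $\delta_{\psi_\sharp}$ in $\bar{\mathcal P}^{\psi,\varphi}_{t-1}$ are predicted with $\bar q^\alpha_t$ (the appearing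 targets). Every hypothesis for a target (in $\mathbb I^{\mathrm m}_{t-1}$, in the never-detected group, or remaining at $\psi_\sharp$) is predicted with $\bar q^\pi_t$ and with $\bar q^\omega_t$; by (A.1) both resulting hypotheses are kept simultaneously, each with the multiplicity of the original. The false-alarm generators are predicted with $\bar q^\pi_t$. Then (S.1) and (S.2) are applied. $\mathbb I^{\mathrm m}_{t|t-1}$ indexes the predicted hypotheses for previously detected targets and is identified with the set of pairs $(k,\iota)\in\mathbb I^{\mathrm m}_{t-1}\times\{\pi,\omega\}$. *)

theory Defs
  imports "HOL-Analysis.Analysis"
begin

(* \<open>'a state\<close> is the state space X, \<open>'a xstate\<close> its extension by the virtual state phi.
   \<open>Sharp\<close>: outside the area of interest; \<open>Flat\<close>: false-alarm generator. *)

datatype 'a state = Kinematic 'a | Sharp | Flat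

datatype 'a xstate = Actual "'a state" | Phi

(* Densities are ennreal-valued, as in the library's measure theory, so that the integrals
   below are always defined. *)

type_synonym 'd law = "(real ^ 'd) xstate \<Rightarrow> ennreal"

definition integral_X :: "((real ^ 'd::finite) state \<Rightarrow> ennreal) \<Rightarrow> ennreal" where
  "integral_X f = (\<integral>\<^sup>+ x. f (Kinematic x) \<partial>lborel) + f Sharp + f Flat"

definition integral_Xbar :: "((real ^ 'd::finite) xstate \<Rightarrow> ennreal) \<Rightarrow> ennreal" where
  "integral_Xbar f = integral_X (\<lambda>x. f (Actual x)) + f Phi"

definition prob_law :: "'d::finite law \<Rightarrow> bool" where
  "prob_law p \<longleftrightarrow>
     (\<lambda>x. p (Actual (Kinematic x))) \<in> borel_measurable borel \<and> integral_Xbar p = 1"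

(* Equality almost everywhere with respect to the reference measure of \<open>integral_Xbar\<close>, which
   has unit mass at each of the isolated points. *)
definition law_eq :: "'d::finite law \<Rightarrow> 'd law \<Rightarrow> bool" where
  "law_eq p p' \<longleftrightarrow>
     (AE x in lborel. p (Actual (Kinematic x)) = p' (Actual (Kinematic x))) \<and>
     p (Actual Sharp) = p' (Actual Sharp) \<and> p (Actual Flat) = p' (Actual Flat) \<and> p Phi = p' Phi"

(* The point a is meant to be isolated. *)
definition point_law :: "(real ^ 'd::finite) xstate \<Rightarrow> 'd law" where
  "point_law a x = (if x = a then 1 else 0)"

datatype transition = Appearance | Persistence | Disappearance

(* \<open>q x' x\<close> stands for q(x' | x). *)
type_synonym 'd kernel = "(real ^ 'd) state \<Rightarrow> (real ^ 'd) state \<Rightarrow> ennreal"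

definition sub_transition :: "'d::finite kernel \<Rightarrow> bool" where
  "sub_transition q \<longleftrightarrow>
     (\<lambda>(x', x). q (Kinematic x') (Kinematic x)) \<in> borel_measurable (borel \<Otimes>\<^sub>M borel) \<and>
     (\<forall>a \<in> {Sharp, Flat}. (\<lambda>x'. q (Kinematic x') a) \<in> borel_measurable borel \<and>
                          (\<lambda>x. q a (Kinematic x)) \<in> borel_measurable borel) \<and>
     (\<forall>x. integral_X (\<lambda>x'. q x' x) \<le> 1) \<and>
     (\<forall>x. x \<noteq> Flat \<longrightarrow> q x Flat = 0 \<and> q Flat x = 0)"

definition transition_model :: "(transition \<Rightarrow> 'd::finite kernel) \<Rightarrow> bool" where
  "transition_model q \<longleftrightarrow>
     (\<forall>\<iota>. sub_transition (q \<iota>)) \<and>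
     (\<forall>x' x. x \<noteq> Sharp \<longrightarrow> q Appearance x' x = 0) \<and>
     q Appearance Sharp Sharp = 0 \<and>
     (\<forall>x. q Persistence Sharp (Kinematic x) = 0) \<and>
     q Persistence Sharp Sharp = 1 \<and> q Persistence Flat Flat = 1 \<and>
     (\<forall>x' x. q Disappearance (Kinematic x') (Kinematic x) = 0) \<and>
     (\<forall>x'. q Disappearance x' Sharp = 0 \<and> q Disappearance x' Flat = 0) \<and>
     (\<forall>x. q Disappearance Sharp x + integral_X (\<lambda>x'. q Persistence x' x) = 1)"

(* The truncated subtraction of ennreal is exact here, the integral being at most 1. *)
fun qbar :: "'d::finite kernel \<Rightarrow> (real ^ 'd) xstate \<Rightarrow> (real ^ 'd) xstate \<Rightarrow> ennreal" where
  "qbar q (Actual x') (Actual x) = q x' x"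
| "qbar q Phi (Actual x) = 1 - integral_X (\<lambda>x''. q x'' x)"
| "qbar q (Actual x') Phi = 0"
| "qbar q Phi Phi = 1"

definition predict_law :: "'d::finite kernel \<Rightarrow> 'd law \<Rightarrow> 'd law" where
  "predict_law q p x = integral_Xbar (\<lambda>x'. qbar q x x' * p x')"

(* An indexed family of laws with multiplicities; the domain of the map is the index set. *)
type_synonym ('i, 'd) family = "'i \<rightharpoonup> 'd law \<times> enat"

definition law_of :: "('i, 'd) family \<Rightarrow> 'i \<Rightarrow> 'd law" where
  "law_of C i = fst (the (C i))"

definition mult_of :: "('i, 'd) family \<Rightarrow> 'i \<Rightarrow> enat" where
  "mult_of C i = snd (the (C i))"

definition is_configuration :: "('i, 'd::finite) family \<Rightarrow> bool" where
  "is_configuration C \<longleftrightarrow>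
     (\<forall>i \<in> dom C. prob_law (law_of C i) \<and>
        (mult_of C i = \<infinity> \<longrightarrow>
           (\<exists>a \<in> {Actual Sharp, Actual Flat, Phi}. law_eq (law_of C i) (point_law a))))"

(* Equality up to the reindexing \<sigma> and up to the choice of densities of the laws. *)
definition same_configuration ::
    "('i \<Rightarrow> 'j) \<Rightarrow> ('i, 'd::finite) family \<Rightarrow> ('j, 'd) family \<Rightarrow> bool" where
  "same_configuration \<sigma> C D \<longleftrightarrow>
     bij_betw \<sigma> (dom C) (dom D) \<and>
     (\<forall>i \<in> dom C. law_eq (law_of C i) (law_of D (\<sigma> i)) \<and> mult_of C i = mult_of D (\<sigma> i))"

(* An element of infinite multiplicity absorbs one of finite multiplicity. Two elements of
   infinite multiplicity are never mixed; the value in that case is a dummy. *)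
fun mixture :: "'d law \<times> enat \<Rightarrow> 'd law \<times> enat \<Rightarrow> 'd law \<times> enat" where
  "mixture (p, enat m) (r, enat n) =
     ((\<lambda>x. (of_nat m * p x + of_nat n * r x) / of_nat (m + n)), enat (m + n))"
| "mixture (p, \<infinity>) (r, n) = (p, \<infinity>)"
| "mixture (p, enat m) (r, \<infinity>) = (r, \<infinity>)"

(* The result of mixing the elements i and j keeps the index i. *)
definition mix :: "'i \<Rightarrow> 'i \<Rightarrow> ('i, 'd) family \<Rightarrow> ('i, 'd) family" where
  "mix i j C = C(i \<mapsto> mixture (the (C i)) (the (C j)), j := None)"

(* Element i joins the erroneous hypotheses, element e, if its law is concentrated at phi. *)
definition absorb :: "'i \<Rightarrow> 'i \<Rightarrow> ('i, 'd::finite) family \<Rightarrow> ('i, 'd) family" where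
  "absorb e i C =
     (if law_eq (law_of C i) (point_law Phi)
      then C(e \<mapsto> (law_of C e, mult_of C e + mult_of C i), i := None) else C)"

(* \<open>FalseAlarm f\<close>: generators that already produced false alarms;
   \<open>NoFalseAlarm\<close>: generators that never did. *)
datatype 'f aux = FalseAlarm 'f | NoFalseAlarm | YetToAppear | Erroneous

datatype ('k, 'f) hyp = Detected 'k | Undetected | Auxiliary "'f aux"

fun psi_phi_part :: "'f set \<Rightarrow> ('f \<Rightarrow> nat) \<Rightarrow> enat \<Rightarrow> ('f aux, 'd::finite) family" where
  "psi_phi_part F n_fa n_phi (FalseAlarm f) =
     (if f \<in> F then Some (point_law (Actual Flat), enat (n_fa f)) else None)"
| "psi_phi_part F n_fa n_phi NoFalseAlarm = Some (point_law (Actual Flat), \<infinity>)"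
| "psi_phi_part F n_fa n_phi YetToAppear = Some (point_law (Actual Sharp), \<infinity>)"
| "psi_phi_part F n_fa n_phi Erroneous = Some (point_law Phi, n_phi)"

fun assemble ::
    "'k set \<Rightarrow> ('k \<Rightarrow> 'd law) \<Rightarrow> 'd law \<Rightarrow> nat \<Rightarrow> ('f aux, 'd) family \<Rightarrow> (('k, 'f) hyp, 'd) family"
where
  "assemble I p_m p_u n_u A (Detected k) = (if k \<in> I then Some (p_m k, 1) else None)"
| "assemble I p_m p_u n_u A Undetected = Some (p_u, enat n_u)"
| "assemble I p_m p_u n_u A (Auxiliary a) = A a"

(* \<open>Via h \<iota>\<close> is the hypothesis obtained by predicting the hypothesis h with the transition \<iota>. *)
datatype 'h predicted = Appearing | Via 'h transition | StillErroneous

fun transitions_used :: "('k, 'f) hyp \<Rightarrow> transition set" where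
  "transitions_used (Detected k) = {Persistence, Disappearance}"
| "transitions_used Undetected = {Persistence, Disappearance}"
| "transitions_used (Auxiliary YetToAppear) = {Persistence, Disappearance}"
| "transitions_used (Auxiliary (FalseAlarm f)) = {Persistence}"
| "transitions_used (Auxiliary NoFalseAlarm) = {Persistence}"
| "transitions_used (Auxiliary Erroneous) = {}"

(* Multiplicity left after \<open>n_alpha\<close> of the yet-to-appear targets are set aside as appearing. *)
definition left_over :: "nat \<Rightarrow> ('k, 'f) hyp \<Rightarrow> enat \<Rightarrow> enat" where
  "left_over n_alpha h n = (if h = Auxiliary YetToAppear then n - enat n_alpha else n)"

(* Independence approximation: all the hypotheses \<open>Via h \<iota>\<close> co-exist, each with the multiplicity of h. *)
fun predict_coexisting ::
    "(transition \<Rightarrow> 'd::finite kernel) \<Rightarrow> nat \<Rightarrow> (('k, 'f) hyp, 'd) family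
       \<Rightarrow> (('k, 'f) hyp predicted, 'd) family" where
  "predict_coexisting q n_alpha C Appearing =
     map_option (\<lambda>(p, n). (predict_law (q Appearance) p, enat n_alpha)) (C (Auxiliary YetToAppear))"
| "predict_coexisting q n_alpha C (Via h \<iota>) =
     (if \<iota> \<in> transitions_used h
      then map_option (\<lambda>(p, n). (predict_law (q \<iota>) p, left_over n_alpha h n)) (C h) else None)"
| "predict_coexisting q n_alpha C StillErroneous = C (Auxiliary Erroneous)"

definition mix_appearing ::
    "(('k, 'f) hyp predicted, 'd) family \<Rightarrow> (('k, 'f) hyp predicted, 'd) family" where
  "mix_appearing = mix (Via Undetected Persistence) Appearing"

(* The targets that are still at \<open>Sharp\<close> are those yet to appear, predicted with persistence. *)
definition mix_disappeared ::
    "(('k, 'f) hyp predicted, 'd) family \<Rightarrow> (('k, 'f) hyp predicted, 'd) family" where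
  "mix_disappeared = mix (Via (Auxiliary YetToAppear) Persistence) (Via Undetected Disappearance)"

definition prediction ::
    "(transition \<Rightarrow> 'd::finite kernel) \<Rightarrow> nat \<Rightarrow> (('k, 'f) hyp, 'd) family
       \<Rightarrow> (('k, 'f) hyp predicted, 'd) family" where
  "prediction q n_alpha C =
     absorb StillErroneous (Via (Auxiliary YetToAppear) Disappearance)
       (mix_disappeared (mix_appearing (predict_coexisting q n_alpha C)))"

(* Identification of the indices of the predicted hypotheses; those of previously detected
   targets are identified with pairs (k, \<iota>). *)
fun relabel :: "('k, 'f) hyp predicted \<Rightarrow> ('k \<times> transition, 'f) hyp" where
  "relabel (Via (Detected k) \<iota>) = Detected (k, \<iota>)"
| "relabel (Via Undetected \<iota>) = Undetected"
| "relabel (Via (Auxiliary a) \<iota>) = Auxiliary a"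
| "relabel Appearing = Undetected"
| "relabel StillErroneous = Auxiliary Erroneous"

end

theory Submission
  imports Defs
begin

text \<open>
  Each predicted hypothesis undergoes at most one mixing or absorption, so the formulas for the
  predicted laws are read off once the predicted family has been computed index by index
  (\<open>prediction_values\<close>). What needs an argument is that this family is a configuration and
  that its auxiliary part has the form it had before the prediction.

  Every law remains a probability law, because the extended transition \<open>qbar q\<close> assigns to the
  state \<open>Phi\<close> exactly the mass that the sub-transition \<open>q\<close> loses: its columns have total mass one
  (\<open>integral_qbar_column\<close>), and exchanging the two integrals transfers this to the predicted
  law (\<open>prob_law_predict_law\<close>). Mixing is a convex combination
  (\<open>prob_law_convex_combination\<close>).

  The auxiliary elements return to their place because the isolated points behave as follows under
  the transitions used. Persistence fixes \<open>Flat\<close> and \<open>Sharp\<close>: the transition already has mass one at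
  the point itself, so that nothing remains for the other states, up to a null set. Disappearance
  sends \<open>Sharp\<close> to \<open>Phi\<close>, since \<open>q Disappearance\<close> vanishes there. Hence the targets yet to appear
  contribute one element that is again yet to appear and keeps its infinite multiplicity when
  finitely many targets appear or disappear, and one element of law \<open>\<delta>\<^sub>\<phi>\<close> that is absorbed by the
  erroneous hypotheses. The latter is why the multiplicity of the erroneous hypotheses becomes
  infinite in the predicted configuration.
\<close>

section \<open>Integration over the extended state space\<close>

lemma integral_Xbar_expand:
  "integral_Xbar f = (\<integral>\<^sup>+ x. f (Actual (Kinematic x)) \<partial>lborel)
     + f (Actual Sharp) + f (Actual Flat) + f Phi"
  by (simp add: integral_Xbar_def integral_X_def)

lemma integral_Xbar_add:
  assumes "(\<lambda>x. f (Actual (Kinematic x))) \<in> borel_measurable borel"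
    and "(\<lambda>x. g (Actual (Kinematic x))) \<in> borel_measurable borel"
  shows "integral_Xbar (\<lambda>x. f x + g x) = integral_Xbar f + integral_Xbar g"
  using assms by (simp add: integral_Xbar_expand nn_integral_add ac_simps)

lemma integral_Xbar_cmult:
  assumes "(\<lambda>x. f (Actual (Kinematic x))) \<in> borel_measurable borel"
  shows "integral_Xbar (\<lambda>x. c * f x) = c * integral_Xbar f"
  using assms by (simp add: integral_Xbar_expand nn_integral_cmult distrib_left)

lemma integral_Xbar_divide:
  assumes "(\<lambda>x. f (Actual (Kinematic x))) \<in> borel_measurable borel"
  shows "integral_Xbar (\<lambda>x. f x / c) = integral_Xbar f / c"
  using integral_Xbar_cmult[OF assms, of "inverse c"]
  by (simp add: divide_ennreal_def mult.commute)

text \<open>Tonelli's theorem for the sum of Lebesgue measure and four unit masses. An isolated point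
  contributes a one-variable section of the integrand, and each of these has to be measurable, since
  joint measurability on the kinematic part says nothing about them.\<close>

lemma integral_Xbar_swap:
  fixes f :: "(real ^ 'm::finite) xstate \<Rightarrow> (real ^ 'n::finite) xstate \<Rightarrow> ennreal"
  assumes joint: "(\<lambda>(x, y). f (Actual (Kinematic x)) (Actual (Kinematic y)))
      \<in> borel_measurable (borel \<Otimes>\<^sub>M borel)"
    and left: "\<And>a. a \<in> {Actual Sharp, Actual Flat, Phi} \<Longrightarrow>
      (\<lambda>x. f (Actual (Kinematic x)) a) \<in> borel_measurable borel"
    and right: "\<And>a. a \<in> {Actual Sharp, Actual Flat, Phi} \<Longrightarrow>
      (\<lambda>y. f a (Actual (Kinematic y))) \<in> borel_measurable borel"
  shows "integral_Xbar (\<lambda>x. integral_Xbar (\<lambda>y. f x y)) = integral_Xbar (\<lambda>y. integral_Xbar (\<lambda>x. f x y))"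
proof -
  let ?f = "\<lambda>x y. f (Actual (Kinematic x)) (Actual (Kinematic y))"
  have joint': "case_prod ?f \<in> borel_measurable (lborel \<Otimes>\<^sub>M lborel)"
    using joint by (simp cong: measurable_cong_sets)
  have joint'': "(\<lambda>(y, x). ?f x y) \<in> borel_measurable (lborel \<Otimes>\<^sub>M lborel)"
    using measurable_pair_swap[OF joint'] by (simp add: case_prod_beta)
  have [measurable]: "(\<lambda>x. \<integral>\<^sup>+ y. ?f x y \<partial>lborel) \<in> borel_measurable borel"
    using lborel.borel_measurable_nn_integral[OF joint'] by simp
  have [measurable]: "(\<lambda>y. \<integral>\<^sup>+ x. ?f x y \<partial>lborel) \<in> borel_measurable borel"
    using lborel.borel_measurable_nn_integral[OF joint''] by simp
  have [measurable]:
    "(\<lambda>x. f (Actual (Kinematic x)) (Actual Sharp)) \<in> borel_measurable borel"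
    "(\<lambda>x. f (Actual (Kinematic x)) (Actual Flat)) \<in> borel_measurable borel"
    "(\<lambda>x. f (Actual (Kinematic x)) Phi) \<in> borel_measurable borel"
    "(\<lambda>y. f (Actual Sharp) (Actual (Kinematic y))) \<in> borel_measurable borel"
    "(\<lambda>y. f (Actual Flat) (Actual (Kinematic y))) \<in> borel_measurable borel"
    "(\<lambda>y. f Phi (Actual (Kinematic y))) \<in> borel_measurable borel"
    by (auto intro: left right)
  have "(\<integral>\<^sup>+ x. (\<integral>\<^sup>+ y. ?f x y \<partial>lborel) \<partial>lborel) = (\<integral>\<^sup>+ y. (\<integral>\<^sup>+ x. ?f x y \<partial>lborel) \<partial>lborel)"
    by (rule lborel_pair.Fubini'[symmetric]) (use joint' in simp)
  then show ?thesis
    by (simp add: integral_Xbar_expand nn_integral_add ac_simps)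
qed

lemma integral_Xbar_point_law:
  "integral_Xbar (\<lambda>x. f x * point_law (Actual Sharp) x) = f (Actual Sharp)"
  "integral_Xbar (\<lambda>x. f x * point_law (Actual Flat) x) = f (Actual Flat)"
  by (simp_all add: integral_Xbar_expand point_law_def)

lemma prob_law_point_law:
  "prob_law (point_law (Actual Sharp))" "prob_law (point_law (Actual Flat))" "prob_law (point_law Phi)"
  by (simp_all add: prob_law_def integral_Xbar_expand point_law_def)

lemma prob_law_convex_combination:
  assumes p: "prob_law p" and r: "prob_law r" and pos: "m + n > 0"
  shows "prob_law (\<lambda>x. (of_nat m * p x + of_nat n * r x) / of_nat (m + n))"
proof -
  have [measurable]: "(\<lambda>x. p (Actual (Kinematic x))) \<in> borel_measurable borel"
    "(\<lambda>x. r (Actual (Kinematic x))) \<in> borel_measurable borel"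
    using p r by (simp_all add: prob_law_def)
  have "integral_Xbar (\<lambda>x. (of_nat m * p x + of_nat n * r x) / of_nat (m + n))
      = (of_nat m * integral_Xbar p + of_nat n * integral_Xbar r) / of_nat (m + n)"
    by (subst integral_Xbar_divide, measurable)
      (subst integral_Xbar_add, measurable, simp add: integral_Xbar_cmult)
  also have "\<dots> = of_nat (m + n) / of_nat (m + n)"
    using p r by (simp add: prob_law_def)
  also have "\<dots> = (1 :: ennreal)"
    by (rule ennreal_divide_self) (use pos in \<open>simp_all add: of_nat_less_top del: of_nat_add\<close>)
  finally show ?thesis
    by (simp add: prob_law_def)
qed

lemma law_eq_refl: "law_eq p p"
  by (simp add: law_eq_def)

section \<open>The extended transitions\<close>

text \<open>The mass that the sub-transition loses is sent to the virtual state.\<close>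

lemma integral_qbar_column:
  assumes "sub_transition q"
  shows "integral_Xbar (\<lambda>x. qbar q x x') = 1"
proof (cases x')
  case (Actual y)
  have "integral_X (\<lambda>x. q x y) \<le> 1"
    using assms by (auto simp: sub_transition_def)
  then show ?thesis
    using Actual by (simp add: integral_Xbar_def add_diff_inverse_ennreal)
next
  case Phi
  then show ?thesis
    by (simp add: integral_Xbar_expand)
qed

text \<open>The total mass of a predicted law is a double integral of \<open>qbar q x x' * p x'\<close>; integrating
  over \<open>x\<close> first leaves the total mass of \<open>p\<close>.\<close>

lemma prob_law_predict_law:
  fixes q :: "'d::finite kernel"
  assumes q: "sub_transition q" and p: "prob_law p"
  shows "prob_law (predict_law q p)"
proof -
  let ?q = "\<lambda>x' x. q (Kinematic x') (Kinematic x)"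
  have p_meas [measurable]: "(\<lambda>x. p (Actual (Kinematic x))) \<in> borel_measurable borel"
    using p by (simp add: prob_law_def)
  have q_meas [measurable]: "case_prod ?q \<in> borel_measurable (borel \<Otimes>\<^sub>M borel)"
    using q by (simp add: sub_transition_def)
  have [measurable]:
    "(\<lambda>x'. q (Kinematic x') Sharp) \<in> borel_measurable borel"
    "(\<lambda>x'. q (Kinematic x') Flat) \<in> borel_measurable borel"
    "(\<lambda>x. q Sharp (Kinematic x)) \<in> borel_measurable borel"
    "(\<lambda>x. q Flat (Kinematic x)) \<in> borel_measurable borel"
    using q by (simp_all add: sub_transition_def)
  have joint: "(\<lambda>(x', x). ?q x' x * p (Actual (Kinematic x))) \<in> borel_measurable (borel \<Otimes>\<^sub>M borel)"
    by measurable
  have "(\<lambda>(x, x'). ?q x' x) \<in> borel_measurable (lborel \<Otimes>\<^sub>M lborel)"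
    using measurable_pair_swap[OF q_meas] by (simp add: case_prod_beta cong: measurable_cong_sets)
  from lborel.borel_measurable_nn_integral[OF this]
  have [measurable]: "(\<lambda>x. \<integral>\<^sup>+ x'. ?q x' x \<partial>lborel) \<in> borel_measurable borel"
    by simp
  have [measurable]: "(\<lambda>x. integral_X (\<lambda>x'. q x' (Kinematic x))) \<in> borel_measurable borel"
    unfolding integral_X_def by measurable
  have [measurable]: "(\<lambda>x'. \<integral>\<^sup>+ x. ?q x' x * p (Actual (Kinematic x)) \<partial>lborel) \<in> borel_measurable borel"
    using lborel.borel_measurable_nn_integral[of "\<lambda>x' x. ?q x' x * p (Actual (Kinematic x))" lborel] joint
    by (simp cong: measurable_cong_sets)
  have meas: "(\<lambda>x. predict_law q p (Actual (Kinematic x))) \<in> borel_measurable borel"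
    unfolding predict_law_def integral_Xbar_expand qbar.simps by measurable
  have "integral_Xbar (predict_law q p) = integral_Xbar (\<lambda>x. integral_Xbar (\<lambda>x'. qbar q x x' * p x'))"
    by (simp add: predict_law_def[abs_def])
  also have "\<dots> = integral_Xbar (\<lambda>x'. integral_Xbar (\<lambda>x. qbar q x x' * p x'))"
    by (rule integral_Xbar_swap) (use joint in auto)
  also have "\<dots> = integral_Xbar (\<lambda>x'. p x' * integral_Xbar (\<lambda>x. qbar q x x'))"
  proof -
    have "(\<lambda>x. qbar q (Actual (Kinematic x)) x') \<in> borel_measurable borel" for x'
    proof (cases x' rule: xstate.exhaust)
      case (Actual y)
      have "(\<lambda>x. ?q x z) \<in> borel_measurable borel" for z
        by measurable
      then show ?thesis
        using Actual by (cases y) auto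
    qed auto
    then show ?thesis
      by (simp add: mult.commute integral_Xbar_cmult)
  qed
  also have "\<dots> = 1"
    using p by (simp add: integral_qbar_column[OF q] prob_law_def)
  finally show ?thesis
    using meas by (simp add: prob_law_def)
qed

lemma predict_point_law:
  "predict_law q (point_law (Actual Sharp)) x = qbar q x (Actual Sharp)"
  "predict_law q (point_law (Actual Flat)) x = qbar q x (Actual Flat)"
  by (simp_all add: predict_law_def integral_Xbar_point_law)

text \<open>Mass one at \<open>Sharp\<close> leaves no mass for the kinematic states. The density may still be
  nonzero on a null set of them, which is why the two laws are not equal pointwise.\<close>

lemma persistence_fixes_Sharp:
  assumes "transition_model q"
  shows "law_eq (predict_law (q Persistence) (point_law (Actual Sharp))) (point_law (Actual Sharp))"
proof -
  let ?k = "\<lambda>x. q Persistence (Kinematic x) Sharp"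
  have sub: "sub_transition (q Persistence)" and one: "q Persistence Sharp Sharp = 1"
    using assms by (simp_all add: transition_model_def)
  have flat: "q Persistence Flat Sharp = 0" and [measurable]: "?k \<in> borel_measurable borel"
    and total: "integral_X (\<lambda>x'. q Persistence x' Sharp) \<le> 1"
    using sub by (auto simp: sub_transition_def)
  have sum: "(\<integral>\<^sup>+ x. ?k x \<partial>lborel) + 1 \<le> 1"
    using total one flat by (simp add: integral_X_def)
  have null: "(\<integral>\<^sup>+ x. ?k x \<partial>lborel) = 0"
    using sum ennreal_add_left_cancel_le[of 1 "\<integral>\<^sup>+ x. ?k x \<partial>lborel" 0] by (simp add: add.commute)
  then have "AE x in lborel. ?k x = 0"
    by (subst (asm) nn_integral_0_iff_AE) auto
  then show ?thesis
    using one flat null by (simp add: law_eq_def predict_point_law integral_X_def point_law_def)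
qed

lemma persistence_fixes_Flat:
  assumes "transition_model q"
  shows "predict_law (q Persistence) (point_law (Actual Flat)) = point_law (Actual Flat)"
proof
  have sub: "sub_transition (q Persistence)" and one: "q Persistence Flat Flat = 1"
    using assms by (simp_all add: transition_model_def)
  have other: "q Persistence x Flat = 0" if "x \<noteq> Flat" for x
    using sub that by (simp add: sub_transition_def)
  fix x :: "(real ^ 'a) xstate"
  show "predict_law (q Persistence) (point_law (Actual Flat)) x = point_law (Actual Flat) x"
  proof (cases x)
    case (Actual y)
    then show ?thesis
      using one other by (cases y) (simp_all add: predict_point_law point_law_def)
  next
    case Phi
    then show ?thesis
      using one other by (simp add: predict_point_law point_law_def integral_X_def)
  qed
qed

lemma disappearance_from_Sharp:
  assumes "transition_model q"
  shows "predict_law (q Disappearance) (point_law (Actual Sharp)) = point_law Phi"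
proof
  have zero: "q Disappearance x' Sharp = 0" for x'
    using assms by (simp add: transition_model_def)
  fix x :: "(real ^ 'a) xstate"
  show "predict_law (q Disappearance) (point_law (Actual Sharp)) x = point_law Phi x"
    using zero by (cases x) (simp_all add: predict_point_law point_law_def integral_X_def)
qed

section \<open>The predicted configuration\<close>

text \<open>Both mixings and the absorption are visible in the values: the appearing targets have joined the
  never-detected ones, the element at \<open>Sharp\<close> has taken in the disappeared ones without a change
  because its multiplicity is infinite, and the hypothesis that a target disappears before it has
  appeared has law \<open>\<delta>\<^sub>\<phi>\<close> and passes its infinite multiplicity on to the erroneous hypotheses.\<close>

lemma prediction_values:
  assumes q: "transition_model q"
    and P_def: "P = prediction q n (assemble I p_m p_u n_u (psi_phi_part F n_fa n_phi))"
  shows "P (Via (Detected k) \<iota>) =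
      (if k \<in> I \<and> \<iota> \<in> {Persistence, Disappearance} then Some (predict_law (q \<iota>) (p_m k), 1) else None)"
    and "P (Via Undetected \<iota>) =
      (if \<iota> = Persistence
       then Some (\<lambda>x. (of_nat n_u * predict_law (q Persistence) p_u x
                + of_nat n * qbar (q Appearance) x (Actual Sharp)) / of_nat (n_u + n), enat (n_u + n))
       else None)"
    and "P (Via (Auxiliary (FalseAlarm f)) \<iota>) =
      (if f \<in> F \<and> \<iota> = Persistence then Some (point_law (Actual Flat), enat (n_fa f)) else None)"
    and "P (Via (Auxiliary NoFalseAlarm) \<iota>) =
      (if \<iota> = Persistence then Some (point_law (Actual Flat), \<infinity>) else None)"
    and "P (Via (Auxiliary YetToAppear) \<iota>) =
      (if \<iota> = Persistence
       then Some (predict_law (q Persistence) (point_law (Actual Sharp)), \<infinity>) else None)"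
    and "P (Via (Auxiliary Erroneous) \<iota>) = None"
    and "P Appearing = None"
    and "P StillErroneous = Some (point_law Phi, \<infinity>)"
  by (cases \<iota>; simp add: P_def prediction_def absorb_def mix_disappeared_def mix_appearing_def mix_def
      left_over_def law_of_def mult_of_def law_eq_refl disappearance_from_Sharp[OF q]
      persistence_fixes_Flat[OF q] predict_point_law)+

text \<open>Forgetting which transition led to an auxiliary hypothesis or to the never-detected targets
  identifies no two predicted hypotheses: for each of these, a single element is left after mixing and
  absorption. Only the previously detected targets keep both transitions, and there the new label
  records the transition.\<close>

lemma bij_betw_relabel:
  fixes I :: "'k set" and F :: "'f set"
  assumes q: "transition_model q"
  shows "bij_betw relabel
    (dom (prediction q n (assemble I p_m p_u n_u (psi_phi_part F n_fa n_phi))))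
    (dom (assemble (I \<times> {Persistence, Disappearance}) p_m' p_u' n_u' (psi_phi_part F n_fa n_phi')))"
    (is "bij_betw relabel (dom ?P) (dom ?D)")
proof -
  note at_index = prediction_values[OF q refl]
  define old :: "('k \<times> transition, 'f) hyp \<Rightarrow> ('k, 'f) hyp predicted"
    where "old = (\<lambda>h. case h of
      Detected (k, \<iota>) \<Rightarrow> Via (Detected k) \<iota>
    | Undetected \<Rightarrow> Via Undetected Persistence
    | Auxiliary a \<Rightarrow> if a = Erroneous then StillErroneous else Via (Auxiliary a) Persistence)"
  have left_inv: "relabel h \<in> dom ?D \<and> old (relabel h) = h" if "h \<in> dom ?P" for h
    using that
  proof (induction h rule: relabel.induct)
    case (3 a \<iota>)
    then show ?case
      by (cases a) (auto simp: at_index old_def split: if_splits)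
  qed (auto simp: at_index old_def split: if_splits)
  have right_inv: "old h \<in> dom ?P \<and> relabel (old h) = h" if "h \<in> dom ?D" for h
  proof (cases h)
    case (Auxiliary a)
    then show ?thesis
      using that by (cases a) (auto simp: at_index old_def split: if_splits)
  qed (use that in \<open>auto simp: at_index old_def split: if_splits\<close>)
  show ?thesis
    by (rule bij_betw_byWitness[where f' = old]) (use left_inv right_inv in blast)+
qed

theorem theorem1:
  fixes t :: nat
    and q :: "nat \<Rightarrow> transition \<Rightarrow> 'd::finite kernel"
    and n_alpha n_obs :: "nat \<Rightarrow> nat"
    and I :: "'k set" and p_m :: "'k \<Rightarrow> 'd law"
    and p_u :: "'d law" and n_u :: nat
    and F :: "'f set" and n_fa :: "'f \<Rightarrow> nat" and n_phi :: enat
    and P_prior :: "(('k, 'f) hyp, 'd) family"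
    and P_pred :: "(('k, 'f) hyp predicted, 'd) family"
  assumes "t \<ge> 1"
    and "transition_model (q t)"
    and "n_obs t < n_alpha t"
    and "finite I"
    and "P_prior = assemble I p_m p_u n_u (psi_phi_part F n_fa n_phi)"
    and "is_configuration P_prior"
    and "P_pred = prediction (q t) (n_alpha t) P_prior"
  shows "\<exists>p_m_pred p_u_pred n_u_pred n_phi_pred.
      is_configuration P_pred \<and>
      p_m_pred = (\<lambda>(k, \<iota>). law_of P_pred (Via (Detected k) \<iota>)) \<and>
      p_u_pred = law_of P_pred (Via Undetected Persistence) \<and>
      same_configuration relabel P_pred
        (assemble (I \<times> {Persistence, Disappearance}) p_m_pred p_u_pred n_u_pred
           (psi_phi_part F n_fa n_phi_pred)) \<and>
      n_u_pred = n_u + n_alpha t \<and>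
      (\<forall>x. p_u_pred x =
         (of_nat n_u * integral_Xbar (\<lambda>x'. qbar (q t Persistence) x x' * p_u x')
            + of_nat (n_alpha t) * qbar (q t Appearance) x (Actual Sharp))
         / (of_nat n_u + of_nat (n_alpha t))) \<and>
      (\<forall>k \<in> I. \<forall>\<iota> \<in> {Persistence, Disappearance}. \<forall>x.
         p_m_pred (k, \<iota>) x = integral_Xbar (\<lambda>x'. qbar (q t \<iota>) x x' * p_m k x'))"
proof -
  define P_u where "P_u = law_of P_pred (Via Undetected Persistence)"
  define P_m where "P_m = (\<lambda>(k, \<iota>). law_of P_pred (Via (Detected k) \<iota>))"
  define D :: "(('k \<times> transition, 'f) hyp, 'd) family"
    where "D = assemble (I \<times> {Persistence, Disappearance}) P_m P_u (n_u + n_alpha t)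
      (psi_phi_part F n_fa \<infinity>)"
  note q = assms(2)
  note at_index = prediction_values[OF q assms(7)[unfolded assms(5)]]
  have sub: "sub_transition (q t \<iota>)" for \<iota>
    using q by (simp add: transition_model_def)
  have prior: "prob_law (law_of P_prior h)" if "h \<in> dom P_prior" for h
    using assms(6) that by (simp add: is_configuration_def)
  have p_m: "prob_law (p_m k)" if "k \<in> I" for k
    using prior[of "Detected k"] that assms(5) by (simp add: law_of_def dom_def)
  have p_u: "prob_law p_u"
    using prior[of Undetected] assms(5) by (simp add: law_of_def dom_def)
  have P_u_eq: "P_u = (\<lambda>x. (of_nat n_u * predict_law (q t Persistence) p_u x
      + of_nat (n_alpha t) * qbar (q t Appearance) x (Actual Sharp)) / of_nat (n_u + n_alpha t))"
    by (simp add: P_u_def law_of_def at_index)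
  \<comment> \<open>The strict bound on the number of observations makes the divisor positive, even if no
    target has remained undetected so far.\<close>
  have "n_u + n_alpha t > 0"
    using assms(3) by simp
  from prob_law_convex_combination[OF prob_law_predict_law[OF sub p_u]
      prob_law_predict_law[OF sub prob_law_point_law(1)] this]
  have P_u: "prob_law P_u"
    unfolding P_u_eq by (simp add: predict_point_law)
  have sharp: "law_eq (predict_law (q t Persistence) (point_law (Actual Sharp))) (point_law (Actual Sharp))"
    by (rule persistence_fixes_Sharp[OF q])
  have element: "prob_law (law_of P_pred h) \<and>
      (mult_of P_pred h = \<infinity> \<longrightarrow>
        (\<exists>a \<in> {Actual Sharp, Actual Flat, Phi}. law_eq (law_of P_pred h) (point_law a))) \<and>
      law_eq (law_of P_pred h) (law_of D (relabel h)) \<and> mult_of P_pred h = mult_of D (relabel h)"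
    if h: "h \<in> dom P_pred" for h
  proof (cases h)
    case Appearing
    then show ?thesis using h by (auto simp: at_index)
  next
    case StillErroneous
    then show ?thesis
      by (simp add: at_index D_def law_of_def mult_of_def prob_law_point_law law_eq_refl)
  next
    case (Via g \<iota>)
    show ?thesis
    proof (cases g)
      case (Detected k)
      then show ?thesis
        using h Via p_m[of k]
        by (auto simp: at_index D_def P_m_def law_of_def mult_of_def law_eq_refl one_enat_def
            intro!: prob_law_predict_law[OF sub] split: if_splits)
    next
      case Undetected
      then have h_eq: "h = Via Undetected Persistence"
        using h Via by (auto simp: at_index split: if_splits)
      then show ?thesis
        using P_u by (simp add: at_index D_def P_u_def law_eq_refl)
          (simp add: law_of_def mult_of_def at_index law_eq_refl)
    next
      case (Auxiliary a)
      then show ?thesis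
        using h Via sharp prob_law_predict_law[OF sub prob_law_point_law(1)]
        by (cases a) (auto simp: at_index D_def law_of_def mult_of_def prob_law_point_law law_eq_refl
            split: if_splits)
    qed
  qed
  have "is_configuration P_pred"
    using element by (simp add: is_configuration_def)
  moreover have "same_configuration relabel P_pred D"
    using element bij_betw_relabel[OF q, of "n_alpha t" I p_m p_u n_u F n_fa n_phi]
    by (simp add: same_configuration_def D_def assms(5,7))
  moreover have "P_u x = (of_nat n_u * integral_Xbar (\<lambda>x'. qbar (q t Persistence) x x' * p_u x')
      + of_nat (n_alpha t) * qbar (q t Appearance) x (Actual Sharp))
      / (of_nat n_u + of_nat (n_alpha t))" for x
    by (simp add: P_u_eq predict_law_def)
  moreover have "P_m (k, \<iota>) x = integral_Xbar (\<lambda>x'. qbar (q t \<iota>) x x' * p_m k x')"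
    if "k \<in> I" "\<iota> \<in> {Persistence, Disappearance}" for k \<iota> x
    using that by (auto simp: P_m_def law_of_def at_index predict_law_def)
  ultimately show ?thesis
    using P_u_def P_m_def unfolding D_def by blast
qed

end
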